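(* Let $c_0$ be the rainbow $3$-colouring of $T\cong\mathrm{PG}(1,2)$, i.e. the three points of $T$ receive the three distinct colours $1,2,3$. Then for every $n\in\mathbb N$ and every $c_0$-free $3$-colouring $c:\mathrm{PG}(n-1,2)\to\{1,2,3\}$, there is a subspace $V$ of $\mathrm{PG}(n-1,2)$ with $\dim(V)\ge \tfrac13 n$ and a colour $i\in\{1,2,3\}$ such that no point of $V$ has colour $i$. Moreover the values $C=\tfrac13$ and exponent $\delta=1$ are best possible: there is no pair $(C',\delta')$ with either $\delta'>1$, or $\delta'=1$ and $C'>\tfrac13$, such that every $c_0$-free $3$-colouring of $\mathrm{PG}(n-1,2)$ (for every $n$) has a subspace of dimension at least $C'n^{\delta'}$ avoiding some colour.
   Context: $\mathrm{PG}(n-1,2)$ is the binary projective geometry, whose points may be identified with the nonzero vectors of $\mathbb F_2^n$; a subspace of it is the set of nonzero vectors of a linear subspace of $\mathbb F_2^n$, and its dimension is the dimension of that linear subspace. $T=\mathrm{PG}(1,2)$ is the set of three nonzero vectors of $\mathbb F_2^2$. If $c$ is a colouring of $\mathrm{PG}(n-1,2)$ and $c_0$ a colouring of $\mathrm{PG}(k-1,2)$, then $c$ contains $c_0$ if there is an injective linear map $\psi:\mathbb F_2^k\to\mathbb F_2^n$ with $c(\psi(x))=c_0(x)$ for every nonzero $x\in\mathbb F_2^k$; $c$ is $c_0$-free if it does not contain $c_0$.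
   Formalization: In the optimality claim the constant C' is required to be positive; for C' ≤ 0 and δ' > 1 the bound C'n^{δ'} is at most 0, so the empty subspace meets it and the claim as literally stated would fail. *)

theory Defs
  imports Complex_Main "HOL-Library.Z2" "HOL-Library.Function_Algebras" "HOL-Library.FuncSet"
begin

text \<open>The ambient space for all the \<open>F\<^sub>2\<^sup>n\<close> at once is \<^typ>\<open>nat \<Rightarrow> bit\<close> with pointwise
  operations; \<open>F\<^sub>2\<^sup>n\<close> is embedded as the vectors supported on the coordinates \<open>0, \<dots>, n - 1\<close>.\<close>

type_synonym f2vec = "nat \<Rightarrow> bit"

definition f2_scale :: "bit \<Rightarrow> f2vec \<Rightarrow> f2vec" where
  "f2_scale a v = (\<lambda>j. a * v j)"

interpretation f2: vector_space f2_scale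
  by unfold_locales (auto simp: f2_scale_def fun_eq_iff algebra_simps)

definition f2_space :: "nat \<Rightarrow> f2vec set" where
  "f2_space n = {v. \<forall>j\<ge>n. v j = 0}"

text \<open>\<open>pg n\<close> is the point set of \<open>PG(n - 1, 2)\<close>; the argument is the linear dimension.\<close>

definition pg :: "nat \<Rightarrow> f2vec set" where
  "pg n = f2_space n - {0}"

definition pg_subspace :: "nat \<Rightarrow> f2vec set \<Rightarrow> bool" where
  "pg_subspace n V \<longleftrightarrow> (\<exists>W. f2.subspace W \<and> W \<subseteq> f2_space n \<and> V = W - {0})"

text \<open>The linear, not the projective, dimension: a point has dimension 1 and the empty
  subspace has dimension 0.\<close>

definition pg_dim :: "f2vec set \<Rightarrow> nat" where
  "pg_dim V = f2.dim (insert 0 V)"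

text \<open>Only the values of the map on \<open>F\<^sub>2\<^sup>k\<close> matter.\<close>

definition f2_linear_map :: "nat \<Rightarrow> nat \<Rightarrow> (f2vec \<Rightarrow> f2vec) \<Rightarrow> bool" where
  "f2_linear_map k n \<psi> \<longleftrightarrow>
     \<psi> \<in> f2_space k \<rightarrow> f2_space n \<and>
     (\<forall>x\<in>f2_space k. \<forall>y\<in>f2_space k. \<psi> (x + y) = \<psi> x + \<psi> y) \<and>
     (\<forall>a. \<forall>x\<in>f2_space k. \<psi> (f2_scale a x) = f2_scale a (\<psi> x))"

definition contains_colouring ::
    "nat \<Rightarrow> (f2vec \<Rightarrow> 'c) \<Rightarrow> nat \<Rightarrow> (f2vec \<Rightarrow> 'c) \<Rightarrow> bool" where
  "contains_colouring n c k c0 \<longleftrightarrow>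
     (\<exists>\<psi>. f2_linear_map k n \<psi> \<and> inj_on \<psi> (f2_space k) \<and> (\<forall>x\<in>pg k. c (\<psi> x) = c0 x))"

definition three_colouring :: "nat \<Rightarrow> (f2vec \<Rightarrow> nat) \<Rightarrow> bool" where
  "three_colouring n c \<longleftrightarrow> c \<in> pg n \<rightarrow> {1, 2, 3}"

text \<open>The rainbow colouring of \<open>T = PG(1, 2)\<close> is unique up to a linear automorphism of \<open>F\<^sub>2\<^sup>2\<close>.\<close>

definition rainbow_T :: "(f2vec \<Rightarrow> nat) \<Rightarrow> bool" where
  "rainbow_T c0 \<longleftrightarrow> bij_betw c0 (pg 2) {1, 2, 3}"

end

theory Submission
  imports Defs
begin

text \<open>
  Lower bound: colour the complete graph on \<open>W\<close> by giving the edge \<open>xy\<close> the colour of \<open>x + y\<close>. If no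
  line of \<open>W\<close> is rainbow, this is a Gallai colouring, so some colour \<open>i\<close> induces a disconnected graph,
  that is, the points of colour \<open>i\<close> lie in a hyperplane \<open>H\<close> of \<open>W\<close>. By induction \<open>H\<close> has subspaces
  \<open>S\<^sub>1, S\<^sub>2, S\<^sub>3\<close>, with \<open>S\<^sub>j\<close> avoiding colour \<open>j\<close>, whose dimensions sum to at least \<open>dim H\<close>. Since
  colour \<open>i\<close> does not occur outside \<open>H\<close>, any \<open>b \<in> W - H\<close> can be added to \<open>S\<^sub>i\<close>, so the dimensions sum
  to at least \<open>dim W\<close> and one of them is at least a third of it.

  Sharpness: let \<open>m = d\<^sup>2\<close> with \<open>d\<close> large. By counting, there is a set \<open>A\<close> that neither contains nor is
  disjoint from the points of any \<open>d\<close>-dimensional subspace of \<open>F\<^sub>2\<^sup>m\<close>. Split \<open>F\<^sub>2\<^sup>3\<^sup>m\<close> into three blocks of \<open>m\<close> coordinates and colour a vector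
  according to whether its last nonzero block lies in \<open>A\<close>, with a different pair of colours for each
  block. No line is rainbow, and a subspace avoiding a colour has dimension at most \<open>m\<close> in one block
  and at most \<open>d\<close> in the other two, in total \<open>m + 2d = (1 + o(1)) n / 3\<close> for \<open>n = 3m\<close>.
\<close>

subsection \<open>A cut in a Gallai colouring\<close>

text \<open>Induction on the vertices. The induction hypothesis gives a cut of \<open>F\<close>
  avoiding a colour \<open>i\<close> of \<open>K\<close>, so the graph of colour \<open>i\<close> on
  \<open>F\<close> is disconnected. If \<open>v\<close> spoiled every cut for every colour of
  \<open>K\<close>, it would send edges of all these colours into \<open>F\<close>, against the
  triangle condition.\<close>

lemma gallai_cut:
  fixes e :: "'a \<Rightarrow> 'a \<Rightarrow> 'c"
  assumes "finite V" "2 \<le> card V" "3 \<le> card K"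
    and "\<And>x y. x \<in> V \<Longrightarrow> y \<in> V \<Longrightarrow> e x y = e y x"
    and "\<And>x y z. x \<in> V \<Longrightarrow> y \<in> V \<Longrightarrow> z \<in> V \<Longrightarrow> x \<noteq> y \<Longrightarrow> y \<noteq> z \<Longrightarrow> x \<noteq> z \<Longrightarrow>
           e x y = e y z \<or> e y z = e x z \<or> e x y = e x z"
  shows "\<exists>i\<in>K. \<exists>A. A \<subset> V \<and> A \<noteq> {} \<and> (\<forall>x\<in>A. \<forall>y\<in>V - A. e x y \<noteq> i)"
  using assms
proof (induction V rule: finite_induct)
  case empty
  then show ?case by simp
next
  case (insert v F)
  have sym: "e x y = e y x" if "x \<in> insert v F" "y \<in> insert v F" for x y
    using insert.prems(3) that by blast
  have tri: "e x y = e y z \<or> e y z = e x z \<or> e x y = e x z"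
    if "x \<in> insert v F" "y \<in> insert v F" "z \<in> insert v F" "x \<noteq> y" "y \<noteq> z" "x \<noteq> z" for x y z
    using insert.prems(4) that by blast
  have "F \<noteq> {}" using insert.prems(1) by auto
  have other: "\<exists>j\<in>K. j \<notin> J" if "finite J" "card J \<le> 2" for J
  proof (rule ccontr)
    assume "\<not> ?thesis"
    hence "K \<subseteq> J" by auto
    hence "card K \<le> card J" using that by (simp add: card_mono)
    thus False using that insert.prems(2) by simp
  qed
  show ?case
  proof (cases "card F = 1")
    case True
    then obtain u where F: "F = {u}" by (auto simp: card_1_singleton_iff)
    obtain j where "j \<in> K" "j \<notin> {e u v}" using other[of "{e u v}"] by auto
    thus ?thesis using F insert.hyps
      by (intro bexI[of _ j] exI[of _ "{u}"]) auto
  next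
    case False
    hence "2 \<le> card F" using \<open>F \<noteq> {}\<close> insert.hyps(1)
      by (metis One_nat_def Suc_leI card_gt_0_iff le_neq_implies_less numeral_2_eq_2)
    hence "\<exists>i\<in>K. \<exists>A. A \<subset> F \<and> A \<noteq> {} \<and> (\<forall>x\<in>A. \<forall>y\<in>F - A. e x y \<noteq> i)"
      by (rule insert.IH[OF _ insert.prems(2)]) (use sym tri in simp_all)
    then obtain i A where i: "i \<in> K" and A: "A \<subset> F" "A \<noteq> {}"
      and cut: "\<And>x y. x \<in> A \<Longrightarrow> y \<in> F - A \<Longrightarrow> e x y \<noteq> i"
      by blast
    obtain j where j: "j \<in> K" "j \<noteq> i" using other[of "{i}"] by auto
    obtain k where k: "k \<in> K" "k \<noteq> i" "k \<noteq> j" using other[of "{i,j}"] j by auto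
    \<comment> \<open>The classes of \<open>R\<^sup>*\<close> in \<open>F\<close> are the components
      of colour \<open>i\<close>.\<close>
    define R where "R = {(x,y). x \<in> F \<and> y \<in> F \<and> x \<noteq> y \<and> e x y = i}"
    have "sym R" unfolding R_def using sym by (auto intro!: symI)
    hence symR: "(y,x) \<in> R\<^sup>*" if "(x,y) \<in> R\<^sup>*" for x y
      using that by (metis symD sym_rtrancl)
    have RF: "y \<in> F" if "(x,y) \<in> R\<^sup>*" "x \<in> F" for x y
      using that by (induction rule: rtrancl_induct) (auto simp: R_def)
    show ?thesis
    proof (rule ccontr)
      assume no: "\<not> ?thesis"
      have nocut: "\<exists>x\<in>A. \<exists>y\<in>insert v F - A. e x y = l"
        if "l \<in> K" "A \<subset> insert v F" "A \<noteq> {}" for l A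
        using no that by blast
      have v_edge: "\<exists>g\<in>F. e v g = l" if "l \<in> K" for l
        using nocut[OF that, of "{v}"] \<open>F \<noteq> {}\<close> insert.hyps by auto
      \<comment> \<open>The component of \<open>x\<close> is not a cut, so an edge of colour
        \<open>i\<close> leaves it; such an edge cannot end in \<open>F\<close>.\<close>
      have v_red: "\<exists>y. (x,y) \<in> R\<^sup>* \<and> y \<in> F \<and> e v y = i" if "x \<in> F" for x
      proof -
        have "R\<^sup>* `` {x} \<subset> insert v F" using RF[OF _ that] insert.hyps by auto
        moreover have "R\<^sup>* `` {x} \<noteq> {}" by auto
        ultimately obtain p q where pq: "(x,p) \<in> R\<^sup>*" "q \<in> insert v F" "(x,q) \<notin> R\<^sup>*" "e p q = i"
          using nocut[OF i, of "R\<^sup>* `` {x}"] by auto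
        have p: "p \<in> F" using RF pq(1) that by auto
        have "q = v"
        proof (rule ccontr)
          assume "q \<noteq> v"
          hence "(p,q) \<in> R" using pq p by (auto simp: R_def)
          thus False using pq(1,3) by (meson rtrancl.rtrancl_into_rtrancl)
        qed
        thus ?thesis using pq p sym by auto
      qed
      \<comment> \<open>Along an edge \<open>y w\<close> of colour \<open>i\<close>, the edges from
        \<open>z\<close> to \<open>y\<close> and to \<open>w\<close> do not have colour
        \<open>i\<close>, so the triangle condition makes them agree.\<close>
      have uniform: "e y z = e x z" if "(x,y) \<in> R\<^sup>*" "x \<in> F" "z \<in> F" "(x,z) \<notin> R\<^sup>*" for x y z
        using that(1)
      proof (induction rule: rtrancl_induct)
        case (step y w)
        have w: "w \<in> F" "y \<in> F" "y \<noteq> w" "e y w = i" using step.hyps by (auto simp: R_def)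
        have "(x,w) \<in> R\<^sup>*" using step.hyps by auto
        hence "z \<noteq> y" "z \<noteq> w" "(y,z) \<notin> R" "(w,z) \<notin> R"
          using that(4) step.hyps(1) by (auto dest: rtrancl_into_rtrancl)
        hence "e y z \<noteq> i" "e w z \<noteq> i" using w that by (auto simp: R_def)
        hence "e y z = e w z" using tri[of y w z] w \<open>z \<noteq> y\<close> \<open>z \<noteq> w\<close> that by auto
        thus ?case using step.IH by simp
      qed simp
      \<comment> \<open>Edges between two components of colour \<open>i\<close> in \<open>F\<close> have a single colour, and \<open>v\<close> sends an edge
        of colour \<open>i\<close> to each component; so edges of colours \<open>j\<close> and \<open>k\<close> at \<open>v\<close> clash.\<close>
      obtain g where g: "g \<in> F" "e v g = j" using v_edge j by auto
      obtain h where h: "h \<in> F" "e v h = k" using v_edge k by auto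
      have col: "e x y = e v x"
        if "x \<in> F" "y \<in> F" "(x,y) \<notin> R\<^sup>*" "e v y = i" "e v x \<noteq> i" for x y
      proof -
        have "x \<noteq> y" "(x,y) \<notin> R" "v \<noteq> x" "v \<noteq> y" using that insert.hyps by auto
        hence "e x y \<noteq> i" using that by (auto simp: R_def)
        thus ?thesis using tri[of v x y] that \<open>x \<noteq> y\<close> \<open>v \<noteq> x\<close> \<open>v \<noteq> y\<close> by auto
      qed
      \<comment> \<open>Points on the two sides of the old cut lie in different components, so some
        \<open>t\<close> lies outside the component of \<open>g\<close>.\<close>
      obtain p q where pq: "p \<in> A" "q \<in> F - A" using A by auto
      have "(p,y) \<in> R\<^sup>* \<Longrightarrow> y \<in> A" for y
        by (induction rule: rtrancl_induct) (use pq cut in \<open>auto simp: R_def\<close>)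
      hence "(p,q) \<notin> R\<^sup>*" using pq by auto
      hence "\<exists>t\<in>F. (g,t) \<notin> R\<^sup>*" using pq A symR
        by (metis DiffD1 psubsetD rtrancl_trans)
      then obtain t where t: "t \<in> F" "(g,t) \<notin> R\<^sup>*" by auto
      show False
      proof (cases "(g,h) \<in> R\<^sup>*")
        case True
        \<comment> \<open>The edges from \<open>w\<close> to \<open>g\<close> and \<open>h\<close>
          have colours \<open>j\<close> and \<open>k\<close>, yet must agree because
          \<open>g\<close> and \<open>h\<close> share a component.\<close>
        obtain w where w: "(t,w) \<in> R\<^sup>*" "w \<in> F" "e v w = i" using v_red t by blast
        have "(g,w) \<notin> R\<^sup>*" using w t symR by (meson rtrancl_trans)
        moreover from this have "(h,w) \<notin> R\<^sup>*" using True by (meson rtrancl_trans)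
        ultimately show False using col[of g w] col[of h w] uniform[OF True g(1) w(2)] g h w j k by auto
      next
        case False
        \<comment> \<open>Since \<open>a\<close> and \<open>b\<close> lie in the components of
          \<open>g\<close> and \<open>h\<close>, the edges \<open>g b\<close> of colour
          \<open>j\<close> and \<open>h a\<close> of colour \<open>k\<close> both have the colour of
          \<open>g h\<close>.\<close>
        obtain a where a: "(g,a) \<in> R\<^sup>*" "a \<in> F" "e v a = i" using v_red g by blast
        obtain b where b: "(h,b) \<in> R\<^sup>*" "b \<in> F" "e v b = i" using v_red h by blast
        have ne: "(g,b) \<notin> R\<^sup>*" "(h,a) \<notin> R\<^sup>*" "(h,g) \<notin> R\<^sup>*" using a b False symR by (meson rtrancl_trans)+
        have "e g b = j" using col[of g b] g b ne j by auto
        moreover have "e h a = k" using col[of h a] h a ne k by auto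
        moreover have "e b g = e h g" using uniform[OF b(1) h(1) g(1)] ne by auto
        moreover have "e a h = e g h" using uniform[OF a(1) g(1) h(1)] False by auto
        ultimately show False using sym g h a b k(3) by (metis insertCI)
      qed
    qed
  qed
qed

subsection \<open>Linear algebra over the two-element field\<close>

lemma f2_add_self [simp]: "(v::f2vec) + v = 0"
  by (simp add: fun_eq_iff)

lemma f2_add_left_cancel_self [simp]: "(v::f2vec) + (v + w) = w"
  by (simp add: add.assoc[symmetric])

lemma f2_add_eq_0_iff: "(v::f2vec) + w = 0 \<longleftrightarrow> v = w"
  by (metis add.right_neutral f2_add_left_cancel_self)

lemma f2_scale_simps [simp]: "f2_scale 0 v = 0" "f2_scale 1 v = v"
  by (simp_all add: f2_scale_def fun_eq_iff)

lemma f2_scale_cases: "f2_scale a v = 0 \<or> f2_scale a v = v"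
  by (cases a) auto

lemma f2_subspaceI:
  assumes "0 \<in> W" "\<And>x y. x \<in> W \<Longrightarrow> y \<in> W \<Longrightarrow> x + y \<in> W"
  shows "f2.subspace W"
  unfolding f2.subspace_def using assms f2_scale_cases by metis

text \<open>The only scalars are 0 and 1, so adjoining a vector to a subspace adds just one
  coset.\<close>

lemma f2_subspace_extend:
  assumes "f2.subspace H"
  shows "f2.subspace (H \<union> (+) b ` H)"
proof (rule f2_subspaceI)
  note H = f2.subspace_add[OF assms]
  show "0 \<in> H \<union> (+) b ` H" using f2.subspace_0[OF assms] by simp
  fix x y assume "x \<in> H \<union> (+) b ` H" "y \<in> H \<union> (+) b ` H"
  then consider "x \<in> H" "y \<in> H" | h where "x \<in> H" "y = b + h" "h \<in> H"
    | h where "y \<in> H" "x = b + h" "h \<in> H" | h h' where "x = b + h" "h \<in> H" "y = b + h'" "h' \<in> H"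
    by auto
  thus "x + y \<in> H \<union> (+) b ` H"
  proof cases
    case 4
    hence "x + y = h + h'" by (simp add: ac_simps)
    thus ?thesis using 4 H by simp
  next
    case 2
    hence "x + y = b + (x + h)" by (simp add: ac_simps)
    thus ?thesis using 2 H by auto
  next
    case 3
    hence "x + y = b + (y + h)" by (simp add: ac_simps)
    thus ?thesis using 3 H by auto
  qed (use H in auto)
qed

lemma f2_card_extend:
  assumes "f2.subspace H" "finite H" "b \<notin> H"
  shows "card (H \<union> (+) b ` H) = 2 * card H"
proof -
  have "H \<inter> (+) b ` H = {}"
  proof (rule ccontr)
    assume "H \<inter> (+) b ` H \<noteq> {}"
    then obtain h where "h \<in> H" "b + h \<in> H" by auto
    hence "h + (b + h) \<in> H" using f2.subspace_add[OF assms(1)] by blast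
    thus False using assms(3) by (simp add: ac_simps)
  qed
  thus ?thesis using assms(2) by (simp add: card_Un_disjoint card_image)
qed

lemma f2_span_insert: "f2.span (insert b B) = f2.span B \<union> (+) b ` f2.span B"
proof (intro set_eqI iffI)
  fix x assume "x \<in> f2.span (insert b B)"
  then obtain k where k: "x - f2_scale k b \<in> f2.span B" by (auto simp: f2.span_breakdown_eq)
  show "x \<in> f2.span B \<union> (+) b ` f2.span B"
  proof (cases k)
    case zero thus ?thesis using k by simp
  next
    case one
    hence "b + (x - b) \<in> (+) b ` f2.span B" using k by (metis f2_scale_simps(2) imageI)
    moreover have "b + (x - b) = x" by (simp only: add_diff_eq add_diff_cancel_left')
    ultimately show ?thesis by simp
  qed
next
  fix x assume "x \<in> f2.span B \<union> (+) b ` f2.span B"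
  moreover have "f2.span B \<subseteq> f2.span (insert b B)" by (rule f2.span_mono) auto
  ultimately show "x \<in> f2.span (insert b B)"
    by (auto intro: f2.span_add f2.span_base)
qed

lemma f2_card_span:
  assumes "finite B" "f2.independent B"
  shows "finite (f2.span B) \<and> card (f2.span B) = 2 ^ card B"
  using assms
proof (induction B)
  case (insert b B)
  hence "b \<notin> f2.span B" "f2.independent B" by (auto simp: f2.independent_insert)
  thus ?case using insert f2_card_extend[of "f2.span B" b] by (simp add: f2_span_insert)
qed simp

lemma f2_subspace_basis:
  assumes "f2.subspace W" "finite W"
  obtains B where "B \<subseteq> W" "finite B" "f2.independent B" "f2.span B = W" "card B = f2.dim W"
proof -
  obtain B where B: "B \<subseteq> W" "f2.independent B" "W \<subseteq> f2.span B" "card B = f2.dim W"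
    using f2.basis_exists by blast
  moreover have "f2.span B = W" using B assms(1) f2.span_minimal by blast
  ultimately show ?thesis using that finite_subset[OF B(1) assms(2)] by blast
qed

text \<open>Lets dimensions be handled by counting: sums of dimensions become products of
  cardinalities.\<close>

lemma f2_card_subspace:
  assumes "f2.subspace W" "finite W"
  shows "card W = 2 ^ f2.dim W"
  by (metis assms f2_card_span f2_subspace_basis)

lemma f2_subspace_space: "f2.subspace (f2_space n)"
  by (rule f2_subspaceI) (auto simp: f2_space_def)

lemma f2_finite_card_space: "finite (f2_space n) \<and> card (f2_space n) = 2 ^ n"
proof (induction n)
  case 0
  have "f2_space 0 = {0}" by (auto simp: f2_space_def fun_eq_iff)
  thus ?case by simp
next
  case (Suc n)
  define b :: f2vec where "b = (\<lambda>j. if j = n then 1 else 0)"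
  have "b \<notin> f2_space n" by (simp add: b_def f2_space_def)
  moreover have "f2_space (Suc n) = f2_space n \<union> (+) b ` f2_space n"
  proof (intro set_eqI iffI)
    fix x assume x: "x \<in> f2_space (Suc n)"
    show "x \<in> f2_space n \<union> (+) b ` f2_space n"
    proof (cases "x n")
      case zero
      hence "x \<in> f2_space n" using x by (auto simp: f2_space_def) (metis le_antisym not_less_eq_eq)
      thus ?thesis by simp
    next
      case one
      hence "b + x \<in> f2_space n" using x by (auto simp: f2_space_def b_def)
      hence "b + (b + x) \<in> (+) b ` f2_space n" by blast
      thus ?thesis by simp
    qed
  qed (auto simp: f2_space_def b_def)
  ultimately show ?case using Suc f2_card_extend[OF f2_subspace_space] by simp
qed

lemmas f2_finite_space [simp] = conjunct1[OF f2_finite_card_space]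
lemmas f2_card_space [simp] = conjunct2[OF f2_finite_card_space]

subsection \<open>Subspaces avoiding a colour\<close>

text \<open>A line consists of \<open>x\<close>, \<open>y\<close> and \<open>x + y\<close>. Without
  reference to coordinates, the condition passes to the hyperplanes met in the induction.\<close>

definition rainbow_free :: "f2vec set \<Rightarrow> (f2vec \<Rightarrow> 'c) \<Rightarrow> bool" where
  "rainbow_free W c \<longleftrightarrow> (\<forall>x\<in>W - {0}. \<forall>y\<in>W - {0}. x \<noteq> y \<longrightarrow>
     c x = c y \<or> c y = c (x + y) \<or> c x = c (x + y))"

lemma rainbow_free_subset: "rainbow_free W c \<Longrightarrow> H \<subseteq> W \<Longrightarrow> rainbow_free H c"
  unfolding rainbow_free_def by blast

text \<open>The three edges of a triangle, \<open>x + y\<close>, \<open>y + z\<close> and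
  \<open>x + z\<close>, form a line, so \<open>gallai_cut\<close> applies to the colouring of pairs
  by \<open>c (x + y)\<close>. The subspace is the stabiliser of one side of the cut.\<close>

lemma rainbow_free_proper_subspace:
  assumes W: "f2.subspace W" "finite W" "W \<noteq> {0}" and "3 \<le> card K" and free: "rainbow_free W c"
  shows "\<exists>i\<in>K. \<exists>P. f2.subspace P \<and> P \<subset> W \<and> (\<forall>x\<in>W - P. c x \<noteq> i)"
proof -
  note add = f2.subspace_add[OF W(1)]
  have 0: "0 \<in> W" using f2.subspace_0[OF W(1)] .
  then obtain w where "w \<in> W" "w \<noteq> 0" using W(3) by auto
  hence "{0, w} \<subseteq> W" "card {0, w} = 2" using 0 by auto
  hence card: "2 \<le> card W" using card_mono[OF W(2)] by metis
  have tri: "c (x + y) = c (y + z) \<or> c (y + z) = c (x + z) \<or> c (x + y) = c (x + z)"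
    if "x \<in> W" "y \<in> W" "z \<in> W" "x \<noteq> y" "y \<noteq> z" "x \<noteq> z" for x y z
  proof -
    have "x + y \<in> W - {0}" "y + z \<in> W - {0}" "x + y \<noteq> y + z"
      using add that by (auto simp: f2_add_eq_0_iff add.commute[of y z])
    moreover have "x + y + (y + z) = x + z" by (simp add: ac_simps)
    ultimately show ?thesis using free unfolding rainbow_free_def by metis
  qed
  have "\<exists>i\<in>K. \<exists>A. A \<subset> W \<and> A \<noteq> {} \<and> (\<forall>x\<in>A. \<forall>y\<in>W - A. c (x + y) \<noteq> i)"
    by (rule gallai_cut[OF W(2) card assms(4)]) (simp add: add.commute, rule tri)
  then obtain i A where i: "i \<in> K" and A: "A \<subset> W" "A \<noteq> {}"
    and cut: "\<And>x y. x \<in> A \<Longrightarrow> y \<in> W - A \<Longrightarrow> c (x + y) \<noteq> i"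
    by blast
  \<comment> \<open>The translations preserving \<open>A\<close>. A point \<open>x\<close> of colour
    \<open>i\<close> joins every \<open>y\<close> to \<open>x + y\<close> by an edge of colour
    \<open>i\<close>, which cannot cross the cut, so \<open>x\<close> lies in
    \<open>P\<close>.\<close>
  define P where "P = {x \<in> W. \<forall>y\<in>W. x + y \<in> A \<longleftrightarrow> y \<in> A}"
  have P: "x \<in> W" "\<And>y. y \<in> W \<Longrightarrow> x + y \<in> A \<longleftrightarrow> y \<in> A" if "x \<in> P" for x
    using that by (auto simp: P_def)
  have subP: "f2.subspace P"
  proof (rule f2_subspaceI)
    fix x y assume x: "x \<in> P" and y: "y \<in> P"
    have "x + y + z \<in> A \<longleftrightarrow> z \<in> A" if "z \<in> W" for z
      using P(2)[OF x, of "y + z"] P(2)[OF y that] add P(1)[OF y] that by (simp add: add.assoc)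
    thus "x + y \<in> P" using add P(1)[OF x] P(1)[OF y] by (simp add: P_def)
  qed (simp add: P_def 0)
  obtain a b where ab: "a \<in> A" "b \<in> W" "b \<notin> A" using A by auto
  \<comment> \<open>Translation by \<open>b + a\<close> carries \<open>a\<close> across the cut to
    \<open>b\<close>, so \<open>P\<close> is proper.\<close>
  have "b + a \<notin> P"
  proof
    assume "b + a \<in> P"
    moreover have "a \<in> W" using ab A by auto
    ultimately have "(b + a) + a \<in> A" using P(2) ab(1) by blast
    thus False using ab by (simp add: add.assoc)
  qed
  moreover have "b + a \<in> W" using ab A add by blast
  ultimately have "P \<subset> W" by (auto simp: P_def)
  moreover have "c x \<noteq> i" if x: "x \<in> W - P" for x
  proof -
    obtain y where y: "y \<in> W" "(y \<in> A) \<noteq> (x + y \<in> A)" using x by (auto simp: P_def)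
    have "x + y \<in> W" using x y add by auto
    moreover have "y + (x + y) = x" "(x + y) + y = x" by (simp_all add: ac_simps)
    ultimately show ?thesis using cut[of y "x + y"] cut[of "x + y" y] y by auto
  qed
  ultimately show ?thesis using i subP by blast
qed

text \<open>Take a maximal proper subspace above \<open>P\<close>; adjoining any further vector must
  then give all of \<open>W\<close>.\<close>

lemma f2_hyperplane_containing:
  assumes "f2.subspace P" "P \<subset> W" "f2.subspace W" "finite W"
  obtains H b where "f2.subspace H" "P \<subseteq> H" "b \<in> W - H" "W = H \<union> (+) b ` H"
proof -
  define \<H> where "\<H> = {H. f2.subspace H \<and> P \<subseteq> H \<and> H \<subset> W}"
  have "finite \<H>" using assms(4) by (auto simp: \<H>_def intro: finite_subset[of _ "Pow W"])
  moreover have "P \<in> \<H>" using assms by (auto simp: \<H>_def)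
  ultimately obtain H where H: "H \<in> \<H>" "\<And>H'. H' \<in> \<H> \<Longrightarrow> H \<subseteq> H' \<Longrightarrow> H = H'"
    using finite_has_maximal[of \<H>] by auto
  obtain b where b: "b \<in> W - H" using H(1) by (auto simp: \<H>_def)
  have "H \<union> (+) b ` H \<subseteq> W" using H(1) b f2.subspace_add[OF assms(3)] by (auto simp: \<H>_def)
  moreover have "b + 0 \<in> (+) b ` H" using H(1) f2.subspace_0 by (auto simp: \<H>_def)
  hence "H \<noteq> H \<union> (+) b ` H" using b by auto
  hence "H \<union> (+) b ` H \<notin> \<H>" using H(2) by blast
  ultimately have "W = H \<union> (+) b ` H"
    using H(1) f2_subspace_extend by (auto simp: \<H>_def)
  thus ?thesis using that[of H b] H(1) b by (auto simp: \<H>_def)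
qed

text \<open>The product of cardinalities encodes the sum of dimensions. It is the quantity to carry
  through the induction, since each step doubles exactly one of the subspaces.\<close>

lemma rainbow_free_colour_avoiding_subspaces:
  assumes "f2.subspace W" "finite W" "3 \<le> card K" "rainbow_free W c"
  shows "\<exists>S. (\<forall>i\<in>K. f2.subspace (S i) \<and> S i \<subseteq> W \<and> (\<forall>x\<in>S i - {0}. c x \<noteq> i))
           \<and> card W \<le> (\<Prod>i\<in>K. card (S i))"
  using assms(1,2,4)
proof (induction "card W" arbitrary: W rule: less_induct)
  case less
  have finK: "finite K" using assms(3) by (metis card.infinite not_numeral_le_zero)
  show ?case
  proof (cases "W = {0}")
    case True
    thus ?thesis by (intro exI[of _ "\<lambda>_. {0}"]) simp
  next
    case False
    then obtain i P where i: "i \<in> K" and P: "f2.subspace P" "P \<subset> W"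
      and avoid: "\<And>x. x \<in> W - P \<Longrightarrow> c x \<noteq> i"
      using rainbow_free_proper_subspace[OF less.prems(1,2) _ assms(3) less.prems(3)] by blast
    obtain H b where H: "f2.subspace H" "P \<subseteq> H" "b \<in> W - H" "W = H \<union> (+) b ` H"
      using f2_hyperplane_containing[OF P less.prems(1,2)] .
    have HW: "H \<subset> W" using H by auto
    hence finH: "finite H" using less.prems(2) finite_subset by auto
    have "card H < card W" "rainbow_free H c"
      using psubset_card_mono[OF less.prems(2) HW] rainbow_free_subset[OF less.prems(3)] HW by auto
    from less.hyps[OF this(1) H(1) finH this(2)]
    obtain S where S: "\<And>j. j \<in> K \<Longrightarrow> f2.subspace (S j)" "\<And>j. j \<in> K \<Longrightarrow> S j \<subseteq> H"
       "\<And>j x. j \<in> K \<Longrightarrow> x \<in> S j - {0} \<Longrightarrow> c x \<noteq> j" and card: "card H \<le> (\<Prod>j\<in>K. card (S j))"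
      by blast
    \<comment> \<open>The new coset lies outside \<open>H\<close>, hence outside \<open>P\<close>,
      where colour \<open>i\<close> does not occur.\<close>
    define S' where "S' = S(i := S i \<union> (+) b ` S i)"
    have bH: "b + h \<in> W - H" if "h \<in> H" for h
    proof -
      have "b + h \<notin> H"
      proof
        assume "b + h \<in> H"
        hence "(b + h) + h \<in> H" using f2.subspace_add[OF H(1)] that by blast
        thus False using H(3) by (simp add: add.assoc)
      qed
      thus ?thesis using that H(4) by auto
    qed
    have "f2.subspace (S' j) \<and> S' j \<subseteq> W \<and> (\<forall>x\<in>S' j - {0}. c x \<noteq> j)" if j: "j \<in> K" for j
    proof (cases "j = i")
      case True
      have "f2.subspace (S' i)" using f2_subspace_extend S(1) i by (simp add: S'_def)
      moreover have "S' i \<subseteq> W" using S(2)[OF i] H(4) by (auto simp: S'_def)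
      moreover have "c x \<noteq> i" if "x \<in> S' i - {0}" for x
      proof (cases "x \<in> S i")
        case False
        then obtain h where "h \<in> S i" "x = b + h" using \<open>x \<in> S' i - {0}\<close> by (auto simp: S'_def)
        hence "x \<in> W - P" using bH S(2)[OF i] H(2) by blast
        thus ?thesis by (rule avoid)
      qed (use S(3)[OF i] that in auto)
      ultimately show ?thesis using True by blast
    next
      case False
      have "S j \<subseteq> W" using S(2)[OF j] HW by blast
      thus ?thesis using S(1,3) j False by (simp add: S'_def)
    qed
    moreover have "card W \<le> (\<Prod>j\<in>K. card (S' j))"
    proof -
      have "finite (S i)" "b \<notin> S i" using S(2)[OF i] finH H(3) finite_subset by auto
      hence "card (S' i) = 2 * card (S i)" using f2_card_extend S(1)[OF i] by (simp add: S'_def)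
      moreover have "(\<Prod>j\<in>K - {i}. card (S' j)) = (\<Prod>j\<in>K - {i}. card (S j))"
        by (rule prod.cong) (auto simp: S'_def)
      ultimately have "(\<Prod>j\<in>K. card (S' j)) = 2 * (\<Prod>j\<in>K. card (S j))"
        using prod.remove[OF finK i, of "\<lambda>j. card (S' j)"] prod.remove[OF finK i, of "\<lambda>j. card (S j)"] by simp
      moreover have "card W = 2 * card H" using H f2_card_extend[OF H(1) finH] by simp
      ultimately show ?thesis using card by simp
    qed
    ultimately show ?thesis by blast
  qed
qed

subsection \<open>A set splitting all large subspaces\<close>

lemma card_supersets:
  assumes "finite X" "T \<subseteq> X"
  shows "card {A. A \<subseteq> X \<and> T \<subseteq> A} = 2 ^ (card X - card T)"
proof -
  have "{A. A \<subseteq> X \<and> T \<subseteq> A} = (\<union>) T ` Pow (X - T)"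
  proof (intro set_eqI iffI)
    fix A assume A: "A \<in> {A. A \<subseteq> X \<and> T \<subseteq> A}"
    hence "A = T \<union> (A - T)" "A - T \<in> Pow (X - T)" by auto
    thus "A \<in> (\<union>) T ` Pow (X - T)" by blast
  qed (use assms in auto)
  moreover have "inj_on ((\<union>) T) (Pow (X - T))" by (auto intro!: inj_onI)
  ultimately show ?thesis
    using assms by (simp add: card_image card_Pow card_Diff_subset finite_subset)
qed

lemma card_disjoint_subsets:
  assumes "finite X" "T \<subseteq> X"
  shows "card {A. A \<subseteq> X \<and> T \<inter> A = {}} = 2 ^ (card X - card T)"
proof -
  have "{A. A \<subseteq> X \<and> T \<inter> A = {}} = Pow (X - T)" by auto
  thus ?thesis using assms by (simp add: card_Pow card_Diff_subset finite_subset)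
qed

text \<open>Each such span comes from a \<open>d\<close>-tuple of vectors, and there are
  \<open>(2 ^ m) ^ d\<close> tuples; this crude overcount suffices.\<close>

lemma card_spans_le:
  "finite {f2.span B | B. B \<subseteq> f2_space m \<and> card B = d \<and> finite B}"
  "card {f2.span B | B. B \<subseteq> f2_space m \<and> card B = d \<and> finite B} \<le> 2 ^ (m * d)"
proof -
  let ?E = "{..<d} \<rightarrow>\<^sub>E f2_space m"
  have sub: "{f2.span B | B. B \<subseteq> f2_space m \<and> card B = d \<and> finite B} \<subseteq> (\<lambda>f. f2.span (f ` {..<d})) ` ?E"
  proof safe
    fix B assume B: "B \<subseteq> f2_space m" "finite B" "d = card B"
    then obtain h where "bij_betw h {..<card B} B"
      using ex_bij_betw_nat_finite[of B] by (auto simp: atLeast0LessThan)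
    hence h: "h ` {..<card B} = B" by (rule bij_betw_imp_surj_on)
    have "restrict h {..<card B} ` {..<card B} = B" using h by simp
    moreover have "restrict h {..<card B} \<in> {..<card B} \<rightarrow>\<^sub>E f2_space m" using h B by auto
    ultimately show "f2.span B \<in> (\<lambda>f. f2.span (f ` {..<card B})) ` ({..<card B} \<rightarrow>\<^sub>E f2_space m)"
      by (metis (no_types, lifting) image_eqI)
  qed
  have fin: "finite ?E" by (intro finite_PiE) auto
  have "card ?E = 2 ^ (m * d)" by (simp add: card_PiE power_mult)
  thus "card {f2.span B | B. B \<subseteq> f2_space m \<and> card B = d \<and> finite B} \<le> 2 ^ (m * d)"
    using surj_card_le[OF fin sub] by simp
  show "finite {f2.span B | B. B \<subseteq> f2_space m \<and> card B = d \<and> finite B}"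
    using finite_surj[OF fin sub] .
qed

lemma exists_set_splitting_subspaces:
  assumes "m * d + 2 < 2 ^ d"
  shows "\<exists>A. \<forall>W. f2.subspace W \<and> W \<subseteq> f2_space m \<and> (W - {0} \<subseteq> A \<or> (W - {0}) \<inter> A = {}) \<longrightarrow> card W < 2 ^ d"
proof -
  define X where "X = f2_space m - {0}"
  define \<F> where "\<F> = {f2.span B | B. B \<subseteq> f2_space m \<and> card B = d \<and> finite B \<and> f2.independent B}"
  \<comment> \<open>The sets of points that fail to split \<open>U\<close>. The union bound below
    shows that they do not exhaust the subsets of \<open>X\<close>.\<close>
  define bad where "bad U = {A. A \<subseteq> X \<and> U - {0} \<subseteq> A} \<union> {A. A \<subseteq> X \<and> (U - {0}) \<inter> A = {}}" for U
  have X: "finite X" by (simp add: X_def)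
  have sub: "\<F> \<subseteq> {f2.span B | B. B \<subseteq> f2_space m \<and> card B = d \<and> finite B}" by (auto simp: \<F>_def)
  have finF: "finite \<F>" using finite_subset[OF sub card_spans_le(1)] .
  have cardF: "card \<F> \<le> 2 ^ (m * d)"
    using card_mono[OF card_spans_le(1) sub] card_spans_le(2)[of m d] by linarith
  have U: "U - {0} \<subseteq> X" "card (U - {0}) = 2 ^ d - 1" if UF: "U \<in> \<F>" for U
  proof -
    obtain B where B: "U = f2.span B" "B \<subseteq> f2_space m" "card B = d" "finite B" "f2.independent B"
      using UF unfolding \<F>_def by blast
    have "U \<subseteq> f2_space m" using B f2.span_minimal f2_subspace_space by auto
    thus "U - {0} \<subseteq> X" by (auto simp: X_def)
    show "card (U - {0}) = 2 ^ d - 1"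
      using f2_card_span[OF B(4,5)] B(1,3) f2.span_zero by simp
  qed
  have bad: "card (bad U) \<le> 2 * 2 ^ (card X - (2 ^ d - 1))" if "U \<in> \<F>" for U
    using card_Un_le[of "{A. A \<subseteq> X \<and> U - {0} \<subseteq> A}" "{A. A \<subseteq> X \<and> (U - {0}) \<inter> A = {}}"]
      card_supersets[OF X U(1)[OF that]] card_disjoint_subsets[OF X U(1)[OF that]] U(2)[OF that]
    by (simp add: bad_def)
  have "card (\<Union>U\<in>\<F>. bad U) < card (Pow X)"
  proof (cases "\<F> = {}")
    case False
    then obtain U where "U \<in> \<F>" by auto
    hence le: "2 ^ d - 1 \<le> card X" using U card_mono[OF X] by metis
    have "card (\<Union>U\<in>\<F>. bad U) \<le> (\<Sum>U\<in>\<F>. card (bad U))" by (rule card_UN_le[OF finF])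
    also have "\<dots> \<le> (\<Sum>U\<in>\<F>. 2 * 2 ^ (card X - (2 ^ d - 1)))" by (intro sum_mono bad)
    also have "\<dots> = card \<F> * (2 * 2 ^ (card X - (2 ^ d - 1)))" by simp
    also have "\<dots> \<le> 2 ^ (m * d) * (2 * 2 ^ (card X - (2 ^ d - 1)))" by (intro mult_right_mono cardF) simp
    also have "\<dots> = 2 ^ (m * d + 1 + (card X - (2 ^ d - 1)))" by (simp add: power_add)
    \<comment> \<open>The hypothesis says \<open>m * d + 1 < 2 ^ d - 1\<close>; \<open>le\<close>
      ensures that the subtraction from \<open>card X\<close> is not truncated.\<close>
    also have "\<dots> < 2 ^ card X" by (rule power_strict_increasing) (use assms le in linarith, simp)
    finally show ?thesis using X by (simp add: card_Pow)
  qed (use X in \<open>simp add: card_Pow\<close>)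
  moreover have "finite (\<Union>U\<in>\<F>. bad U)" using finF X by (auto simp: bad_def)
  ultimately have "\<not> Pow X \<subseteq> (\<Union>U\<in>\<F>. bad U)" using card_mono by (meson leD)
  then obtain A where A: "A \<subseteq> X" "\<And>U. U \<in> \<F> \<Longrightarrow> A \<notin> bad U" by auto
  show ?thesis
  proof (intro exI[of _ A] allI impI, elim conjE)
    fix W assume W: "f2.subspace W" "W \<subseteq> f2_space m" and mono: "W - {0} \<subseteq> A \<or> (W - {0}) \<inter> A = {}"
    have finW: "finite W" using finite_subset[OF W(2)] by simp
    show "card W < 2 ^ d"
    proof (rule ccontr)
      assume "\<not> card W < 2 ^ d"
      hence "(2::nat) ^ d \<le> 2 ^ f2.dim W" using f2_card_subspace[OF W(1) finW] by simp
      hence "d \<le> f2.dim W" by simp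
      moreover obtain B where B: "B \<subseteq> W" "finite B" "f2.independent B" "card B = f2.dim W"
        using f2_subspace_basis[OF W(1) finW] by blast
      \<comment> \<open>Being inside \<open>A\<close> or disjoint from \<open>A\<close> passes to
        subspaces, so a larger \<open>W\<close> may be cut down to dimension exactly
        \<open>d\<close>.\<close>
      ultimately obtain B' where B': "B' \<subseteq> B" "card B' = d" "finite B'"
        by (metis obtain_subset_with_card_n)
      have "f2.span B' \<in> \<F>"
        using B' B(1) W(2) f2.independent_mono[OF B(3) B'(1)] unfolding \<F>_def by blast
      moreover have "f2.span B' \<subseteq> W" using B' B W(1) f2.span_minimal by blast
      hence "A \<in> bad (f2.span B')" using mono A(1) unfolding bad_def by blast
      ultimately show False using A(2) by blast
    qed
  qed
qed

subsection \<open>The block colouring\<close>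

lemma f2_subspace_image:
  assumes "f2.subspace W" "\<And>x y. f (x + y) = f x + (f y :: f2vec)"
  shows "f2.subspace (f ` W)"
proof (rule f2_subspaceI)
  have "f 0 = f 0 + f 0" using assms(2)[of 0 0] by simp
  hence "f 0 = 0" by simp
  thus "0 \<in> f ` W" using f2.subspace_0[OF assms(1)] by force
next
  fix x y assume "x \<in> f ` W" "y \<in> f ` W"
  then obtain u v where "u \<in> W" "v \<in> W" "x = f u" "y = f v" by blast
  thus "x + y \<in> f ` W" using f2.subspace_add[OF assms(1), of u v] assms(2)[of u v] by (metis imageI)
qed

lemma f2_subspace_kernel:
  assumes "f2.subspace W" "\<And>x y. f (x + y) = f x + (f y :: f2vec)"
  shows "f2.subspace {w \<in> W. f w = 0}"
proof (rule f2_subspaceI)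
  have "f 0 = f 0 + f 0" using assms(2)[of 0 0] by simp
  thus "0 \<in> {w \<in> W. f w = 0}" using f2.subspace_0[OF assms(1)] by simp
qed (use f2.subspace_add[OF assms(1)] assms(2) in simp)

text \<open>Rank-nullity by counting: \<open>w\<close> is determined by its image and its difference
  from a chosen preimage of that image, which lies in the kernel.\<close>

lemma f2_card_le_image_kernel:
  assumes "f2.subspace W" "finite W" "\<And>x y. f (x + y) = f x + (f y :: f2vec)"
  shows "card W \<le> card (f ` W) * card {w \<in> W. f w = 0}"
proof -
  define s where "s y = (SOME w. w \<in> W \<and> f w = y)" for y
  have s: "s (f w) \<in> W" "f (s (f w)) = f w" if "w \<in> W" for w
  proof -
    have "s (f w) \<in> W \<and> f (s (f w)) = f w"
      unfolding s_def by (rule someI[of _ w]) (use that in simp)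
    thus "s (f w) \<in> W" "f (s (f w)) = f w" by auto
  qed
  let ?g = "\<lambda>w. (f w, s (f w) + w)"
  have "inj_on ?g W" by (auto intro!: inj_onI)
  moreover have "?g ` W \<subseteq> f ` W \<times> {w \<in> W. f w = 0}"
    using s f2.subspace_add[OF assms(1)] by (auto simp: assms(3))
  ultimately have "card W \<le> card (f ` W \<times> {w \<in> W. f w = 0})"
    using assms(2) by (intro card_inj_on_le) auto
  thus ?thesis by (simp add: card_cartesian_product)
qed

text \<open>Each block is shifted down to the coordinates below \<open>m\<close>, so that one set
  \<open>A\<close> serves all blocks.\<close>

definition block :: "nat \<Rightarrow> nat \<Rightarrow> f2vec \<Rightarrow> f2vec" where
  "block m k x = (\<lambda>j. if j < m then x (j + k * m) else 0)"

lemma block_add: "block m k (x + y) = block m k x + block m k y"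
  by (simp add: block_def fun_eq_iff)

lemma block_0 [simp]: "block m k 0 = 0"
  by (simp add: block_def fun_eq_iff)

lemma block_in_space: "block m k x \<in> f2_space m"
  by (simp add: block_def f2_space_def)

lemma eq_0_if_blocks_0:
  assumes "x \<in> f2_space (3 * m)" "block m 0 x = 0" "block m 1 x = 0" "block m 2 x = 0"
  shows "x = 0"
proof -
  have b: "x (j + k * m) = 0" if "j < m" "block m k x = 0" for j k
    using fun_cong[OF that(2), of j] that(1) by (simp add: block_def)
  have "x j = 0" for j
  proof -
    consider "j < m" | "m \<le> j" "j < 2 * m" | "2 * m \<le> j" "j < 3 * m" | "3 * m \<le> j" by linarith
    thus ?thesis
    proof cases
      case 1 thus ?thesis using b[of j 0] assms by simp
    next
      case 2 thus ?thesis using b[of "j - m" 1] assms by simp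
    next
      case 3 thus ?thesis using b[of "j - 2 * m" 2] assms by simp
    next
      case 4 thus ?thesis using assms(1) by (simp add: f2_space_def)
    qed
  qed
  thus ?thesis by (simp add: fun_eq_iff)
qed

text \<open>Each colour is missing from the pair of exactly one block: 1 from block 2, 2 from block
  1, 3 from block 0.\<close>

definition block_colouring :: "nat \<Rightarrow> f2vec set \<Rightarrow> f2vec \<Rightarrow> nat" where
  "block_colouring m A x =
     (if block m 2 x \<noteq> 0 then if block m 2 x \<in> A then 2 else 3
      else if block m 1 x \<noteq> 0 then if block m 1 x \<in> A then 1 else 3
      else if block m 0 x \<in> A then 1 else 2)"

lemma three_colouring_block_colouring: "three_colouring n (block_colouring m A)"
  by (simp add: three_colouring_def block_colouring_def)

text \<open>Look at the highest block where \<open>x\<close> or \<open>y\<close> is nonzero. If only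
  one is nonzero there, \<open>x + y\<close> shares its block and colour; if the blocks agree,
  \<open>x\<close> and \<open>y\<close> have the same colour; otherwise all three points use the two
  colours of that block. In block 0 only two colours are available anyway.\<close>

lemma rainbow_free_block_colouring: "rainbow_free W (block_colouring m A)"
  unfolding rainbow_free_def
proof (intro ballI impI)
  fix x y
  let ?c = "block_colouring m A"
  show "?c x = ?c y \<or> ?c y = ?c (x + y) \<or> ?c x = ?c (x + y)"
  proof (cases "block m 2 x = 0 \<and> block m 2 y = 0")
    case top: True
    show ?thesis
    proof (cases "block m 1 x = 0 \<and> block m 1 y = 0")
      case True
      thus ?thesis using top by (simp add: block_colouring_def block_add)
    next
      case False
      thus ?thesis using top
        by (cases "block m 1 x = block m 1 y") (auto simp: block_colouring_def block_add f2_add_eq_0_iff)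
    qed
  next
    case False
    thus ?thesis
      by (cases "block m 2 x = block m 2 y") (auto simp: block_colouring_def block_add f2_add_eq_0_iff)
  qed
qed

text \<open>Filter \<open>W\<close> by the vanishing of block 2 and then block 1, and bound
  \<open>card W\<close> by the product of the images under the leading blocks. The block whose pair
  lacks \<open>i\<close> contributes at most \<open>2 ^ m\<close>, each of the others at most
  \<open>2 ^ d\<close>.\<close>

lemma block_colouring_avoiding_dim_le:
  assumes A: "\<And>W. f2.subspace W \<Longrightarrow> W \<subseteq> f2_space m \<Longrightarrow>
      W - {0} \<subseteq> A \<or> (W - {0}) \<inter> A = {} \<Longrightarrow> card W \<le> 2 ^ d"
    and W: "f2.subspace W" "W \<subseteq> f2_space (3 * m)"
    and i: "i \<in> {1, 2, 3}" "\<And>x. x \<in> W - {0} \<Longrightarrow> block_colouring m A x \<noteq> i"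
  shows "f2.dim W \<le> m + 2 * d"
proof -
  define W1 where "W1 = {w \<in> W. block m 2 w = 0}"
  define W0 where "W0 = {w \<in> W1. block m 1 w = 0}"
  have "f2.subspace W1" unfolding W1_def by (rule f2_subspace_kernel[OF W(1) block_add])
  moreover from this have "f2.subspace W0" unfolding W0_def by (rule f2_subspace_kernel[OF _ block_add])
  ultimately have sub: "f2.subspace W1" "f2.subspace W0" by auto
  have fin: "finite W" "finite W1" "finite W0"
    using finite_subset[OF W(2)] by (simp_all add: W1_def W0_def)
  let ?U = "block m 2 ` W" and ?V = "block m 1 ` W1" and ?T = "block m 0 ` W0"
  have sp: "f2.subspace ?U" "f2.subspace ?V" "f2.subspace ?T"
    by (rule f2_subspace_image[OF _ block_add]; fact sub W(1))+
  have le: "?U \<subseteq> f2_space m" "?V \<subseteq> f2_space m" "?T \<subseteq> f2_space m"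
    using block_in_space by auto
  have le_m: "card ?U \<le> 2 ^ m" "card ?V \<le> 2 ^ m" "card ?T \<le> 2 ^ m"
    using le card_mono[OF f2_finite_space[of m]] by auto
  have "{w \<in> W0. block m 0 w = 0} = {0}"
  proof -
    have "0 \<in> {w \<in> W0. block m 0 w = 0}"
      using f2.subspace_0[OF f2_subspace_kernel[of W0 "block m 0"]] sub(2) block_add by blast
    moreover have "w = 0" if "w \<in> W0" "block m 0 w = 0" for w
      using eq_0_if_blocks_0[of w m] that W(2) by (auto simp: W0_def W1_def)
    ultimately show ?thesis by blast
  qed
  hence "card W0 \<le> card ?T"
    using f2_card_le_image_kernel[OF sub(2) fin(3), of "block m 0"] block_add by simp
  moreover have "card W1 \<le> card ?V * card W0"
    using f2_card_le_image_kernel[OF sub(1) fin(2), of "block m 1"] block_add by (simp add: W0_def)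
  moreover have "card W \<le> card ?U * card W1"
    using f2_card_le_image_kernel[OF W(1) fin(1), of "block m 2"] block_add by (simp add: W1_def)
  ultimately have card: "card W \<le> card ?U * (card ?V * card ?T)"
    by (meson le_trans mult_le_mono2)
  \<comment> \<open>A nonzero element of the image is the leading block of a point of
    \<open>W\<close>, so the avoided colour decides its membership in \<open>A\<close> whenever this
    block uses that colour.\<close>
  have colU: "(x \<in> A \<longrightarrow> i \<noteq> 2) \<and> (x \<notin> A \<longrightarrow> i \<noteq> 3)" if x: "x \<in> ?U - {0}" for x
  proof -
    obtain w where w: "w \<in> W" "x = block m 2 w" using x by auto
    hence "w \<noteq> 0" using x by auto
    thus ?thesis using i(2)[of w] w x by (auto simp: block_colouring_def)
  qed
  have colV: "(x \<in> A \<longrightarrow> i \<noteq> 1) \<and> (x \<notin> A \<longrightarrow> i \<noteq> 3)" if x: "x \<in> ?V - {0}" for x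
  proof -
    obtain w where w: "w \<in> W" "block m 2 w = 0" "x = block m 1 w" using x by (auto simp: W1_def)
    hence "w \<noteq> 0" using x by auto
    thus ?thesis using i(2)[of w] w x by (auto simp: block_colouring_def)
  qed
  have colT: "(x \<in> A \<longrightarrow> i \<noteq> 1) \<and> (x \<notin> A \<longrightarrow> i \<noteq> 2)" if x: "x \<in> ?T - {0}" for x
  proof -
    obtain w where w: "w \<in> W" "block m 2 w = 0" "block m 1 w = 0" "x = block m 0 w"
      using x by (auto simp: W1_def W0_def)
    hence "w \<noteq> 0" using x by auto
    thus ?thesis using i(2)[of w] w x by (auto simp: block_colouring_def)
  qed
  have U: "card ?U \<le> 2 ^ d" if "i = 2 \<or> i = 3"
    by (rule A[OF sp(1) le(1)]) (use colU that in blast)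
  have V: "card ?V \<le> 2 ^ d" if "i = 1 \<or> i = 3"
    by (rule A[OF sp(2) le(2)]) (use colV that in blast)
  have T: "card ?T \<le> 2 ^ d" if "i = 1 \<or> i = 2"
    by (rule A[OF sp(3) le(3)]) (use colT that in blast)
  have "card ?U * (card ?V * card ?T) \<le> 2 ^ m * (2 ^ d * 2 ^ d)"
  proof -
    consider "i = 1" | "i = 2" | "i = 3" using i(1) by auto
    thus ?thesis
    proof cases
      case 1
      thus ?thesis using V T le_m(1) by (intro mult_le_mono) auto
    next
      case 2
      hence "card ?V * (card ?U * card ?T) \<le> 2 ^ m * (2 ^ d * 2 ^ d)"
        using U T le_m(2) by (intro mult_le_mono) auto
      thus ?thesis by (simp add: mult.left_commute)
    next
      case 3
      hence "card ?T * (card ?U * card ?V) \<le> 2 ^ m * (2 ^ d * 2 ^ d)"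
        using U V le_m(3) by (intro mult_le_mono) auto
      thus ?thesis by (simp add: ac_simps)
    qed
  qed
  also have "\<dots> = 2 ^ (m + 2 * d)" by (simp add: power_add mult_2)
  finally have "(2::nat) ^ f2.dim W \<le> 2 ^ (m + 2 * d)"
    using card f2_card_subspace[OF W(1) fin(1)] by linarith
  thus ?thesis by simp
qed

subsection \<open>Containing the rainbow colouring\<close>

lemma f2_space_2:
  obtains e f where "f2_space 2 = {0, e, f, e + f}" "e \<noteq> 0" "f \<noteq> 0" "e \<noteq> f"
    "e 0 = 1" "e 1 = 0" "f 0 = 0" "f 1 = 1"
proof -
  define e f :: f2vec where "e = (\<lambda>j. if j = 0 then 1 else 0)" and "f = (\<lambda>j. if j = 1 then 1 else 0)"
  have ev: "e 0 = 1" "e 1 = 0" "f 0 = 0" "f 1 = 1" by (auto simp: e_def f_def)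
  have "v \<in> {0, e, f, e + f}" if "v \<in> f2_space 2" for v
  proof -
    have eq: "v = w" if "w \<in> f2_space 2" "v 0 = w 0" "v 1 = w 1" for w
    proof
      fix j show "v j = w j"
        using that \<open>v \<in> f2_space 2\<close> by (cases "j = 0"; cases "j = 1") (auto simp: f2_space_def)
    qed
    have "{0, e, f, e + f} \<subseteq> f2_space 2" by (auto simp: f2_space_def e_def f_def)
    thus ?thesis
      using eq[of 0] eq[of e] eq[of f] eq[of "e + f"] ev by (cases "v 0"; cases "v 1") simp_all
  qed
  moreover have "{0, e, f, e + f} \<subseteq> f2_space 2" by (auto simp: f2_space_def e_def f_def)
  ultimately have "f2_space 2 = {0, e, f, e + f}" by blast
  moreover have "e \<noteq> 0" "f \<noteq> 0" "e \<noteq> f" using ev by force+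
  ultimately show ?thesis using that ev by blast
qed

text \<open>Two distinct nonzero vectors over the two-element field are independent, so copies of
  \<open>T\<close> are exactly the lines \<open>x\<close>, \<open>y\<close>,
  \<open>x + y\<close>.\<close>

lemma contains_rainbow_iff:
  assumes "rainbow_T c0" "three_colouring n c"
  shows "contains_colouring n c 2 c0 \<longleftrightarrow> \<not> rainbow_free (f2_space n) c"
proof -
  obtain e f where ef: "f2_space 2 = {0, e, f, e + f}" "e \<noteq> 0" "f \<noteq> 0" "e \<noteq> f"
    and ev: "e 0 = 1" "e 1 = 0" "f 0 = 0" "f 1 = 1" by (rule f2_space_2)
  have ef0: "e + f \<noteq> 0" "e + f \<noteq> e" "e + f \<noteq> f" using ef by (auto simp: f2_add_eq_0_iff)
  have ef_mem: "e \<in> f2_space 2" "f \<in> f2_space 2" "e + f \<in> f2_space 2" "0 \<in> f2_space 2" unfolding ef(1) by simp_all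
  have pg: "pg 2 = {e, f, e + f}" using ef ef0 by (auto simp: pg_def)
  have bij: "bij_betw c0 {e, f, e + f} {1, 2, 3}" using assms(1) by (simp add: rainbow_T_def pg)
  hence c0: "c0 e \<noteq> c0 f" "c0 f \<noteq> c0 (e + f)" "c0 e \<noteq> c0 (e + f)" "{c0 e, c0 f, c0 (e + f)} = {1, 2, 3}"
    using ef ef0 by (auto simp: bij_betw_def inj_on_def)
  show ?thesis
  proof
    assume "contains_colouring n c 2 c0"
    then obtain \<psi> where lin: "f2_linear_map 2 n \<psi>" and inj: "inj_on \<psi> (f2_space 2)"
      and col: "\<forall>x\<in>pg 2. c (\<psi> x) = c0 x" by (auto simp: contains_colouring_def)
    have mem: "\<psi> v \<in> f2_space n" if "v \<in> f2_space 2" for v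
      using lin that by (auto simp: f2_linear_map_def)
    have sum: "\<psi> (e + f) = \<psi> e + \<psi> f" using lin ef_mem unfolding f2_linear_map_def by blast
    have "\<psi> (f2_scale 0 e) = f2_scale 0 (\<psi> e)" using lin ef_mem unfolding f2_linear_map_def by blast
    hence "\<psi> 0 = 0" by simp
    hence "\<psi> e \<noteq> 0" "\<psi> f \<noteq> 0" "\<psi> e \<noteq> \<psi> f"
      using inj_onD[OF inj] ef ef_mem by metis+
    moreover have "\<psi> e \<in> f2_space n" "\<psi> f \<in> f2_space n" using mem ef_mem by auto
    moreover have "c (\<psi> e) = c0 e" "c (\<psi> f) = c0 f" "c (\<psi> e + \<psi> f) = c0 (e + f)"
      using col pg sum by auto
    ultimately show "\<not> rainbow_free (f2_space n) c"
      using c0 unfolding rainbow_free_def by (metis DiffI singletonD)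
  next
    assume "\<not> rainbow_free (f2_space n) c"
    then obtain x y where xy: "x \<in> pg n" "y \<in> pg n" "x \<noteq> y"
      and cxy: "c x \<noteq> c y" "c y \<noteq> c (x + y)" "c x \<noteq> c (x + y)"
      by (auto simp: rainbow_free_def pg_def)
    have xy_pg: "x + y \<in> pg n"
      using xy f2.subspace_add[OF f2_subspace_space] by (simp add: pg_def f2_add_eq_0_iff)
    have "c x \<in> {1,2,3}" "c y \<in> {1,2,3}" "c (x + y) \<in> {1,2,3}"
      using assms(2) xy xy_pg unfolding three_colouring_def by blast+
    hence cols: "{c x, c y, c (x + y)} = {1, 2, 3}" using cxy by auto
    \<comment> \<open>The rainbow line may carry its colours in another order than
      \<open>c0\<close>; its points are renamed to match, as any two of them sum to the
      third.\<close>
    have "\<exists>X Y. X \<in> pg n \<and> Y \<in> pg n \<and> c X = c0 e \<and> c Y = c0 f \<and> c (X + Y) = c0 (e + f)"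
    proof -
      have "c0 e \<in> c ` {x, y, x + y}" "c0 f \<in> c ` {x, y, x + y}" using cols c0(4) by auto
      then obtain X Y where XY: "X \<in> {x, y, x + y}" "Y \<in> {x, y, x + y}" "c X = c0 e" "c Y = c0 f"
        by (elim imageE) simp
      hence "X \<noteq> Y" using c0(1) by auto
      have "X + Y \<in> {x, y, x + y}" "X + Y \<noteq> X" "X + Y \<noteq> Y"
        using XY(1,2) \<open>X \<noteq> Y\<close> xy xy_pg by (auto simp: pg_def ac_simps)
      moreover have "inj_on c {x, y, x + y}" using cxy by (auto simp: inj_on_def)
      ultimately have "c (X + Y) \<noteq> c X" "c (X + Y) \<noteq> c Y" "c (X + Y) \<in> c ` {x, y, x + y}"
        using XY(1,2) by (simp_all only: inj_on_eq_iff imageI not_False_eq_True)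
      hence "c (X + Y) \<noteq> c0 e" "c (X + Y) \<noteq> c0 f" "c (X + Y) \<in> {1, 2, 3}"
        using XY(3,4) cols by simp_all
      hence "c (X + Y) = c0 (e + f)" using c0 by blast
      thus ?thesis using XY xy xy_pg by blast
    qed
    then obtain X Y where XY: "X \<in> pg n" "Y \<in> pg n" "c X = c0 e" "c Y = c0 f" "c (X + Y) = c0 (e + f)"
      by blast
    have ne: "X \<noteq> 0" "Y \<noteq> 0" "X \<noteq> Y" using XY c0 by (auto simp: pg_def)
    note S = f2_subspace_space[of n]
    define \<psi> where "\<psi> v = f2_scale (v 0) X + f2_scale (v 1) Y" for v :: f2vec
    have \<psi>: "\<psi> 0 = 0" "\<psi> e = X" "\<psi> f = Y" "\<psi> (e + f) = X + Y"
      by (simp_all add: \<psi>_def ev ev[unfolded One_nat_def])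
    have \<psi>_add: "\<psi> (v + w) = \<psi> v + \<psi> w" for v w
      by (simp only: \<psi>_def plus_fun_apply f2.scale_left_distrib ac_simps)
    have "f2_linear_map 2 n \<psi>"
      unfolding f2_linear_map_def
    proof (intro conjI ballI allI funcsetI)
      fix v show "\<psi> v \<in> f2_space n"
        unfolding \<psi>_def using XY S by (intro f2.subspace_add f2.subspace_scale) (auto simp: pg_def)
      show "\<psi> (v + w) = \<psi> v + \<psi> w" for w by (rule \<psi>_add)
      show "\<psi> (f2_scale a v) = f2_scale a (\<psi> v)" for a
        by (cases a) (simp_all add: \<psi>_def)
    qed
    moreover have "inj_on \<psi> (f2_space 2)"
    proof (rule inj_onI)
      fix v w assume vw: "v \<in> f2_space 2" "w \<in> f2_space 2" "\<psi> v = \<psi> w"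
      have "\<psi> u \<noteq> 0" if "u \<in> {e, f, e + f}" for u
        using that ne by (auto simp: \<psi> f2_add_eq_0_iff)
      moreover have "\<psi> (v + w) = 0" using vw by (simp add: \<psi>_add)
      moreover have "v + w \<in> {0, e, f, e + f}"
        using f2.subspace_add[OF f2_subspace_space vw(1,2)] ef(1) by simp
      ultimately have "v + w = 0" by blast
      thus "v = w" by (simp add: f2_add_eq_0_iff)
    qed
    moreover have "\<forall>v\<in>pg 2. c (\<psi> v) = c0 v" unfolding pg using XY \<psi> by auto
    ultimately show "contains_colouring n c 2 c0" unfolding contains_colouring_def by blast
  qed
qed

section \<open>Projective dimension and growth estimates\<close>

lemma pg_dim_minus_0: "f2.subspace W \<Longrightarrow> pg_dim (W - {0}) = f2.dim W"
  by (simp add: pg_dim_def insert_absorb f2.subspace_0)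

text \<open>The counting condition of \<open>exists_set_splitting_subspaces\<close> for
  \<open>m = d\<^sup>2\<close>. The induction starts from 1002 < 1024.\<close>

lemma cube_lt_power2:
  assumes "10 \<le> d"
  shows "d ^ 3 + 2 < (2::nat) ^ d"
  using assms
proof (induction d rule: dec_induct)
  case (step d)
  have "3 * d\<^sup>2 + 3 * d + 1 \<le> d ^ 3"
  proof -
    have "3 * d + 1 \<le> 4 * d" using step by simp
    also have "\<dots> \<le> d * d" using step by (intro mult_right_mono) auto
    finally have "3 * d\<^sup>2 + 3 * d + 1 \<le> 4 * d\<^sup>2" by (simp add: power2_eq_square)
    also have "\<dots> \<le> d * d\<^sup>2" using step by (intro mult_right_mono) auto
    finally show ?thesis by (simp add: power3_eq_cube power2_eq_square)
  qed
  moreover have "Suc d ^ 3 = d ^ 3 + 3 * d\<^sup>2 + 3 * d + 1"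
    by (simp add: power3_eq_cube power2_eq_square algebra_simps)
  ultimately show ?case using step by simp
qed simp

text \<open>Compares the bound \<open>m + 2 * d\<close> of the block colouring, for
  \<open>m = d\<^sup>2\<close>, with the claimed bound at \<open>n = 3 * m\<close>.\<close>

lemma exists_dim_bound_violation:
  fixes C \<delta> :: real
  assumes "C > 0" "\<delta> > 1 \<or> \<delta> = 1 \<and> C > 1 / 3"
  shows "\<exists>d\<ge>10. real (d\<^sup>2 + 2 * d) < C * real (3 * d\<^sup>2) powr \<delta>"
  using assms(2)
proof
  assume \<delta>: "\<delta> > 1"
  \<comment> \<open>Chosen so that \<open>n powr (\<delta> - 1)\<close> is at least
    \<open>1 / C + 1\<close>; the extra 1 makes the comparison with \<open>1 / C\<close> strict.
    Then even \<open>n\<close> itself is below the claimed bound.\<close>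
  obtain d0 :: nat where d0: "(1 / C + 1) powr (1 / (\<delta> - 1)) \<le> real d0" using real_arch_simple by blast
  define d where "d = max d0 10"
  have d: "10 \<le> d" "(1 / C + 1) powr (1 / (\<delta> - 1)) \<le> real d" using d0 by (auto simp: d_def)
  let ?n = "real (3 * d\<^sup>2)"
  have "d \<le> 3 * d\<^sup>2" by (simp add: power2_eq_square)
  hence dn: "real d \<le> ?n" by (rule of_nat_mono)
  have n0: "?n > 0" using d by simp
  have "1 / C + 1 = ((1 / C + 1) powr (1 / (\<delta> - 1))) powr (\<delta> - 1)"
    using \<delta> assms(1) by (simp add: powr_powr add_pos_pos)
  also have "\<dots> \<le> ?n powr (\<delta> - 1)"
    using d(2) dn \<delta> by (intro powr_mono2) auto
  finally have "C * (1 / C) < C * ?n powr (\<delta> - 1)" using assms(1) by (intro mult_strict_left_mono) auto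
  hence "1 < C * ?n powr (\<delta> - 1)" using assms(1) by simp
  hence "?n * 1 < ?n * (C * ?n powr (\<delta> - 1))" by (rule mult_strict_left_mono[OF _ n0])
  also have "\<dots> = C * ?n powr \<delta>" using n0 by (simp add: powr_diff)
  finally have "?n < C * ?n powr \<delta>" by simp
  moreover have "d\<^sup>2 + 2 * d \<le> 3 * d\<^sup>2" using d by (simp add: power2_eq_square)
  hence "real (d\<^sup>2 + 2 * d) \<le> ?n" by (rule of_nat_mono)
  ultimately show ?thesis using d(1) by (intro exI[of _ d]) linarith
next
  assume \<delta>: "\<delta> = 1 \<and> C > 1 / 3"
  \<comment> \<open>For positive \<open>d\<close>,
    \<open>d\<^sup>2 + 2 * d < 3 * C * d\<^sup>2\<close> amounts to
    \<open>2 < (3 * C - 1) * d\<close>.\<close>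
  obtain d0 :: nat where d0: "2 / (3 * C - 1) < real d0" using reals_Archimedean2 by blast
  define d where "d = max d0 10"
  have d: "10 \<le> d" "2 / (3 * C - 1) < real d" using d0 by (auto simp: d_def)
  hence "2 < (3 * C - 1) * real d" using \<delta> by (simp add: field_simps)
  hence "2 * real d < (3 * C - 1) * real d * real d" using d(1) by (intro mult_strict_right_mono) auto
  hence "real (d\<^sup>2 + 2 * d) < C * real (3 * d\<^sup>2) powr \<delta>"
    using \<delta> d(1) by (simp add: power2_eq_square algebra_simps)
  thus ?thesis using d(1) by blast
qed

theorem theorem1p6:
  fixes c0 :: "f2vec \<Rightarrow> nat"
  assumes "rainbow_T c0"
  shows "(\<forall>n c. three_colouring n c \<and> \<not> contains_colouring n c 2 c0 \<longrightarrow>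
            (\<exists>V. pg_subspace n V \<and> real (pg_dim V) \<ge> 1 / 3 * real n \<and>
              (\<exists>i\<in>{1, 2, 3}. \<forall>x\<in>V. c x \<noteq> i)))
       \<and> \<not> (\<exists>(C'::real) (\<delta>'::real). C' > 0 \<and> (\<delta>' > 1 \<or> \<delta>' = 1 \<and> C' > 1 / 3) \<and>
            (\<forall>n c. three_colouring n c \<and> \<not> contains_colouring n c 2 c0 \<longrightarrow>
              (\<exists>V. pg_subspace n V \<and> real (pg_dim V) \<ge> C' * real n powr \<delta>' \<and>
                (\<exists>i\<in>{1, 2, 3}. \<forall>x\<in>V. c x \<noteq> i))))"
proof (intro conjI allI impI notI; elim conjE exE)
  fix n and c :: "f2vec \<Rightarrow> nat"
  assume "three_colouring n c" "\<not> contains_colouring n c 2 c0"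
  hence free: "rainbow_free (f2_space n) c" using contains_rainbow_iff[OF assms] by blast
  define K where "K = {1, 2, 3 :: nat}"
  hence "3 \<le> card K" by simp
  from rainbow_free_colour_avoiding_subspaces[OF f2_subspace_space f2_finite_space this free]
  obtain S where S: "\<And>i. i \<in> K \<Longrightarrow> f2.subspace (S i)" "\<And>i. i \<in> K \<Longrightarrow> S i \<subseteq> f2_space n"
      "\<And>i x. i \<in> K \<Longrightarrow> x \<in> S i - {0} \<Longrightarrow> c x \<noteq> i"
    and card: "card (f2_space n) \<le> (\<Prod>i\<in>K. card (S i))" by blast
  have "card (S i) = 2 ^ f2.dim (S i)" if "i \<in> K" for i
    using f2_card_subspace[OF S(1)[OF that] finite_subset[OF S(2)[OF that] f2_finite_space]] .
  hence "(2::nat) ^ n \<le> 2 ^ (f2.dim (S 1) + (f2.dim (S 2) + f2.dim (S 3)))"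
    using card by (simp add: K_def power_add)
  hence "n \<le> f2.dim (S 1) + (f2.dim (S 2) + f2.dim (S 3))" by simp
  hence "\<exists>i\<in>K. n \<le> 3 * f2.dim (S i)" unfolding K_def by simp linarith
  then obtain i where i: "i \<in> K" "n \<le> 3 * f2.dim (S i)" by blast
  have "pg_subspace n (S i - {0})" using S(1,2)[OF i(1)] unfolding pg_subspace_def by blast
  moreover have "real (pg_dim (S i - {0})) \<ge> 1 / 3 * real n"
    using i(2) pg_dim_minus_0[OF S(1)[OF i(1)]] by simp
  ultimately show "\<exists>V. pg_subspace n V \<and> real (pg_dim V) \<ge> 1 / 3 * real n \<and>
              (\<exists>i\<in>{1, 2, 3}. \<forall>x\<in>V. c x \<noteq> i)"
    using i(1) S(3)[OF i(1)] unfolding K_def by blast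
next
  fix C \<delta> :: real
  assume C: "C > 0" "\<delta> > 1 \<or> \<delta> = 1 \<and> C > 1 / 3"
    and all: "\<forall>n c. three_colouring n c \<and> \<not> contains_colouring n c 2 c0 \<longrightarrow>
              (\<exists>V. pg_subspace n V \<and> real (pg_dim V) \<ge> C * real n powr \<delta> \<and>
                (\<exists>i\<in>{1, 2, 3}. \<forall>x\<in>V. c x \<noteq> i))"
  obtain d where d: "10 \<le> d" "real (d\<^sup>2 + 2 * d) < C * real (3 * d\<^sup>2) powr \<delta>"
    using exists_dim_bound_violation[OF C] by blast
  \<comment> \<open>With \<open>m = d\<^sup>2\<close> the term \<open>2 * d\<close> is negligible
    against \<open>m\<close>, while \<open>m * d\<close> stays below \<open>2 ^ d\<close>.\<close>
  have "d\<^sup>2 * d + 2 < 2 ^ d" using cube_lt_power2[OF d(1)] by (simp add: power2_eq_square power3_eq_cube)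
  then obtain A where A: "\<And>W. f2.subspace W \<Longrightarrow> W \<subseteq> f2_space (d\<^sup>2) \<Longrightarrow>
      W - {0} \<subseteq> A \<or> (W - {0}) \<inter> A = {} \<Longrightarrow> card W \<le> 2 ^ d"
    using exists_set_splitting_subspaces by (meson less_imp_le)
  let ?c = "block_colouring (d\<^sup>2) A"
  have three: "three_colouring (3 * d\<^sup>2) ?c" by (rule three_colouring_block_colouring)
  hence "\<not> contains_colouring (3 * d\<^sup>2) ?c 2 c0"
    using contains_rainbow_iff[OF assms] rainbow_free_block_colouring by blast
  then obtain V i where V: "pg_subspace (3 * d\<^sup>2) V" "real (pg_dim V) \<ge> C * real (3 * d\<^sup>2) powr \<delta>"
    and i: "i \<in> {1, 2, 3}" "\<forall>x\<in>V. ?c x \<noteq> i" using all three by blast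
  obtain W where W: "f2.subspace W" "W \<subseteq> f2_space (3 * d\<^sup>2)" "V = W - {0}"
    using V(1) by (auto simp: pg_subspace_def)
  have "f2.dim W \<le> d\<^sup>2 + 2 * d"
    by (rule block_colouring_avoiding_dim_le[OF A W(1,2) i(1)]) (use i(2) W(3) in auto)
  hence "pg_dim V \<le> d\<^sup>2 + 2 * d" using W pg_dim_minus_0 by simp
  hence "real (pg_dim V) \<le> real (d\<^sup>2 + 2 * d)" by (rule of_nat_mono)
  thus False using V(2) d(2) by linarith
qed

end
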